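(* Let $x^*$ be the unique root of $8x^3 - 22x^2 + 10x - 1$ in $[0,1/6]$, and let $d\in[0,x^*]$. Consider maximizing $$\widehat{W}_5(f)=\frac{\frac1{1-d}-1}{1-2d}+\frac{1-2d}{f-4d}\left(\frac{\frac1{1-d}-\frac1f}{f-2d}+\frac{\frac1{1-d}-1}{1-2d}\right)$$ over $f\in[1-d,1]$. Then the maximum is attained at $f=1$. In particular, the maximum value is at most $1$, with equality if and only if $d=x^*$. *)

theory Defs
  imports Complex_Main
begin

definition is_root_in_range :: "real \<Rightarrow> bool" where
  "is_root_in_range x \<longleftrightarrow> x \<in> {0..1/6} \<and> 8 * x ^ 3 - 22 * x ^ 2 + 10 * x - 1 = 0"

definition x_star :: real where
  "x_star = (THE x. is_root_in_range x)"

text \<open>For \<^term>\<open>0 \<le> d\<close>, \<^term>\<open>d \<le> 1/6\<close> and \<^term>\<open>f \<in> {1-d..1}\<close> every denominator below is positive, so the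
  convention that division by zero yields zero plays no role.\<close>

definition W5_hat :: "real \<Rightarrow> real \<Rightarrow> real" where
  "W5_hat d f =
     (1 / (1 - d) - 1) / (1 - 2 * d)
     + (1 - 2 * d) / (f - 4 * d)
       * ((1 / (1 - d) - 1 / f) / (f - 2 * d) + (1 / (1 - d) - 1) / (1 - 2 * d))"

end

theory Submission
  imports Defs
begin

text \<open>Write \<open>p x = 8x^3 - 22x^2 + 10x - 1\<close>, which is strictly increasing on \<open>[0, 1/6]\<close>, and
  substitute \<open>f = 1 - t\<close> with \<open>0 \<le> t \<le> d\<close>. After clearing the (positive) denominators, the inequality
  \<open>W(1 - t) \<le> W(1)\<close> becomes
  \<open>t (-p d + d t (5 - 8d - 2t)) \<ge> 0\<close>, and \<open>W(1) \<le> 1\<close> becomes \<open>p d \<le> 0\<close>. Both hold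
  precisely because \<open>d \<le> x*\<close> gives \<open>p d \<le> 0\<close>.\<close>

definition root_cubic :: "real \<Rightarrow> real" where
  "root_cubic x = 8 * x ^ 3 - 22 * x ^ 2 + 10 * x - 1"

lemma root_cubic_strict_mono:
  assumes "0 \<le> x" "x < y" "y \<le> 1/6"
  shows "root_cubic x < root_cubic y"
proof -
  have "root_cubic y - root_cubic x = (y - x) * (8 * (x\<^sup>2 + x * y + y\<^sup>2) + (10 - 22 * (x + y)))"
    unfolding root_cubic_def by algebra
  \<comment> \<open>Since \<open>x + y < 1/3\<close>, the part \<open>10 - 22 * (x + y)\<close>
    exceeds 8/3.\<close>
  moreover have "8 * (x\<^sup>2 + x * y + y\<^sup>2) + (10 - 22 * (x + y)) > 0"
    using assms by (intro add_nonneg_pos) auto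
  ultimately show ?thesis
    using assms by (metis diff_gt_0_iff_gt mult_pos_pos)
qed

lemma ex1_root_in_range: "\<exists>!x. is_root_in_range x"
proof -
  have "\<exists>x\<ge>0. x \<le> 1/6 \<and> root_cubic x = 0"
    \<comment> \<open>The sign changes: the cubic is -1 at 0 and 5/54 at 1/6.\<close>
    by (rule IVT') (auto simp: root_cubic_def power3_eq_cube power2_eq_square intro!: continuous_intros)
  moreover have "x = y" if "is_root_in_range x" "is_root_in_range y" for x y
    using that root_cubic_strict_mono[of x y] root_cubic_strict_mono[of y x]
    by (cases x y rule: linorder_cases) (auto simp: is_root_in_range_def root_cubic_def)
  ultimately show ?thesis
    by (metis atLeastAtMost_iff is_root_in_range_def root_cubic_def)
qed

lemma x_star: "0 \<le> x_star" "x_star \<le> 1/6" "root_cubic x_star = 0"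
  using theI'[OF ex1_root_in_range]
  by (auto simp: x_star_def is_root_in_range_def root_cubic_def)

text \<open>Subtracting 1 from the value at \<open>f = 1\<close> leaves the defining cubic of
  \<open>x_star\<close> as numerator, so the bound 1 and its equality case depend only on the sign
  of \<open>root_cubic d\<close>.\<close>

lemma W5_hat_1:
  assumes "0 \<le> d" "d \<le> 1/6"
  shows "W5_hat d 1 = 1 + root_cubic d / ((1 - d) * (1 - 2 * d) * (1 - 4 * d))"
proof -
  have "1 - d \<noteq> 0" "1 - 2 * d \<noteq> 0" "1 - 4 * d \<noteq> 0"
    using assms by auto
  then show ?thesis
    unfolding W5_hat_def root_cubic_def
    by (simp add: divide_simps) algebra
qed

text \<open>The factor \<open>t\<close> reflects that the difference vanishes at
  \<open>f = 1\<close>. The smallest denominator factor is \<open>1 - t - 4 * d\<close>, at least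
  1/6 because \<open>t \<le> d \<le> 1/6\<close>.\<close>

lemma W5_hat_diff:
  assumes "0 \<le> d" "d \<le> 1/6" "0 \<le> t" "t \<le> d"
  shows "W5_hat d 1 - W5_hat d (1 - t) =
    t * (d * t * (5 - 8 * d - 2 * t) - root_cubic d) /
      ((1 - d) * (1 - 4 * d) * (1 - t) * (1 - t - 2 * d) * (1 - t - 4 * d))"
proof -
  have "1 - d \<noteq> 0" "1 - 2 * d \<noteq> 0" "1 - 4 * d \<noteq> 0" "1 - t \<noteq> 0" "1 - t - 2 * d \<noteq> 0"
    "1 - t - 4 * d \<noteq> 0"
    using assms by auto
  then show ?thesis
    unfolding W5_hat_def root_cubic_def
    by (simp add: divide_simps) algebra
qed

lemma W5_hat_le_W5_hat_1:
  assumes "0 \<le> d" "d \<le> 1/6" "root_cubic d \<le> 0" "f \<in> {1 - d..1}"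
  shows "W5_hat d f \<le> W5_hat d 1"
proof -
  define t where "t = 1 - f"
  have t: "0 \<le> t" "t \<le> d" "f = 1 - t"
    using assms by (auto simp: t_def)
  \<comment> \<open>Here \<open>8 * d + 2 * t\<close> is at most 5/3, well below 5.\<close>
  have "0 \<le> d * t * (5 - 8 * d - 2 * t)"
    using assms t by (intro mult_nonneg_nonneg) auto
  then have "0 \<le> d * t * (5 - 8 * d - 2 * t) - root_cubic d"
    using assms(3) by linarith
  then have "0 \<le> W5_hat d 1 - W5_hat d (1 - t)"
    unfolding W5_hat_diff[OF assms(1,2) t(1,2)]
    using assms t by (intro divide_nonneg_nonneg mult_nonneg_nonneg) auto
  then show ?thesis
    using t by simp
qed

theorem theorem4p16:
  shows "(\<exists>!x. is_root_in_range x) \<and>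
    (\<forall>d \<in> {0..x_star}.
       is_arg_max (W5_hat d) (\<lambda>f. f \<in> {1 - d..1}) 1 \<and>
       W5_hat d 1 \<le> 1 \<and>
       (W5_hat d 1 = 1 \<longleftrightarrow> d = x_star))"
proof (intro conjI ballI ex1_root_in_range)
  fix d
  assume "d \<in> {0..x_star}"
  then have d: "0 \<le> d" "d \<le> x_star" "d \<le> 1/6"
    using x_star(2) by auto
  \<comment> \<open>Strictness away from \<open>x_star\<close> is what later forces
    \<open>d = x_star\<close> in the equality case.\<close>
  have neg: "root_cubic d < 0" if "d \<noteq> x_star"
    using root_cubic_strict_mono[of d x_star] that d x_star by auto
  then have nonpos: "root_cubic d \<le> 0"
    using x_star(3) by fastforce
  have pos: "(1 - d) * (1 - 2 * d) * (1 - 4 * d) > 0"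
    using d by simp
  show "is_arg_max (W5_hat d) (\<lambda>f. f \<in> {1 - d..1}) 1"
    using W5_hat_le_W5_hat_1[OF d(1,3) nonpos] d(1)
    by (auto simp: is_arg_max_def not_less)
  show "W5_hat d 1 \<le> 1"
    using nonpos pos by (simp add: W5_hat_1[OF d(1,3)] divide_nonpos_pos)
  have "W5_hat d 1 = 1 \<longleftrightarrow> root_cubic d = 0"
    using pos by (auto simp: W5_hat_1[OF d(1,3)])
  then show "W5_hat d 1 = 1 \<longleftrightarrow> d = x_star"
    using neg x_star(3) by fastforce
qed

end
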